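(* Let $D=\psi(Z)$ be the period-doubling word and let $C$ be the coloring of the set of factors of $D$ given by $C(u)=C_Z(W(u))$. Then no suffix of $D$ admits a super-monochromatic factorisation for $C$, i.e. there is no suffix $y=u_1u_2u_3\ldots$ of $D$ (with nonempty finite $u_i$) such that all words $u_{n_1}\cdots u_{n_k}$ ($k\geq1$, $n_1<\cdots<n_k$) are factors of $D$ having the same $C$-color.
   Context: Zimin word: alphabet $\{x_1,x_2,\ldots\}$, $Z_1=x_1$, $Z_{m+1}=Z_mx_{m+1}Z_m$, $Z=\lim Z_m$. $\psi$ is the morphism to $\{0,1\}^+$ with $\psi(x_n)=0$ for $n$ odd and $\psi(x_n)=1$ for $n$ even; $D=\psi(Z)=0100010101\ldots$. For a factor $V$ of $Z$, $A_Z(V)$ is the starting position of its first occurrence in $Z$. For a factor $u$ of $D$, $W(u)$ is the factor $V$ of $Z$ with $\psi(V)=u$ for which $A_Z(V)$ is minimal. $C_Z$ is the following coloring of factors of $Z$: write a factor $V$ uniquely as $V=u_Ax_{k(V)}v_B$ with $A,B\subset[1,k(V)[$, where $k(V)=\max\{k:x_k\text{ occurs in }V\}$, $[a,b[=\{a,\ldots,b-1\}$, $u_1=v_1=x_1$, $u_{m+1}=x_{m+1}u_1\cdots u_m$, $v_{m+1}=v_m\cdots v_1x_{m+1}$, $u_A=u_{i_1}\cdots u_{i_k}$ for $A=\{i_1<\cdots<i_k\}$, $v_B=v_{j_k}\cdots v_{j_1}$ for $B=\{j_1<\cdots<j_k\}$; let $\eta(V)=\max([1,k(V)[\setminus A)$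 (or $0$ if $A=[1,k(V)[$); then $C_Z(V)=\textbf{red}$ if $A\cap[1,\eta(V)[=[1,\eta(V)[\setminus(B\cap[1,\eta(V)[)$ and $\textbf{blue}$ otherwise. Since $C$ is defined only on factors of $D$, a super-monochromatic factorisation for $C$ requires every finite ordered concatenation to be a factor of $D$. *)

theory Defs
  imports "HOL-Library.Omega_Words_Fun"
begin

text \<open>
  The letter \<open>x\<^sub>n\<close> (\<open>n \<ge> 1\<close>) is represented by the number \<open>n\<close>. Infinite words are
  functions on \<^typ>\<open>nat\<close>, so positions are counted from \<open>0\<close>.
\<close>

primrec zimin :: "nat \<Rightarrow> nat list" where
  "zimin 0 = []"
| "zimin (Suc m) = zimin m @ [Suc m] @ zimin m"

text \<open>
  Each \<^term>\<open>zimin m\<close> is a prefix of \<^term>\<open>zimin (Suc m)\<close> and has length \<open>2 ^ m - 1\<close>; reading the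
  letter at position \<open>n\<close> off \<^term>\<open>zimin (Suc n)\<close> yields the limit word, see \<open>prefix_zimin_word\<close>.
\<close>

definition zimin_word :: "nat word" where
  "zimin_word n = zimin (Suc n) ! n"

lemma length_zimin: "length (zimin m) = 2 ^ m - 1"
  by (induction m) (auto simp: Suc_diff_Suc)

lemma nth_zimin_add: "i < length (zimin m) \<Longrightarrow> zimin (m + d) ! i = zimin m ! i"
proof (induction d)
  case (Suc d)
  have "length (zimin m) \<le> length (zimin (m + d))"
    by (simp add: length_zimin diff_le_mono)
  with Suc show ?case by (simp add: nth_append)
qed simp

lemma nth_zimin: "i < length (zimin m) \<Longrightarrow> zimin m ! i = zimin_word i"
proof -
  assume i: "i < length (zimin m)"
  have "Suc i < 2 ^ Suc i" by (rule less_exp)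
  then have i': "i < length (zimin (Suc i))" by (simp add: length_zimin)
  show ?thesis
    using nth_zimin_add[OF i, of "Suc i"] nth_zimin_add[OF i', of m]
    unfolding zimin_word_def by (simp only: add.commute)
qed

lemma prefix_zimin_word: "prefix (length (zimin m)) zimin_word = zimin m"
  by (rule nth_equalityI) (auto simp: nth_zimin subsequence_def)

definition psi :: "nat \<Rightarrow> nat" where
  "psi n = (if odd n then 0 else 1)"

definition period_doubling :: "nat word" where
  "period_doubling = psi \<circ> zimin_word"

definition factor :: "'a word \<Rightarrow> 'a list \<Rightarrow> bool" where
  "factor w V \<longleftrightarrow> (\<exists>i. w [i \<rightarrow> i + length V] = V)"

definition first_occ :: "'a word \<Rightarrow> 'a list \<Rightarrow> nat" where
  "first_occ w V = (LEAST i. w [i \<rightarrow> i + length V] = V)"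

definition lift_factor :: "nat list \<Rightarrow> nat list" where
  "lift_factor u = (ARG_MIN (first_occ zimin_word) V. factor zimin_word V \<and> map psi V = u)"

text \<open>
  The words \<open>u\<^sub>m\<close> and \<open>v\<^sub>m\<close>; for \<open>m = 1\<close> the lists of smaller indices are empty, which gives
  \<open>u\<^sub>1 = v\<^sub>1 = x\<^sub>1\<close>. The value at \<open>m = 0\<close> is irrelevant.
\<close>

fun uword :: "nat \<Rightarrow> nat list" where
  "uword m = m # concat (map uword [1..<m])"

fun vword :: "nat \<Rightarrow> nat list" where
  "vword m = concat (map vword (rev [1..<m])) @ [m]"

declare uword.simps [simp del] vword.simps [simp del]

definition uprod :: "nat set \<Rightarrow> nat list" where
  "uprod A = concat (map uword (sorted_list_of_set A))"

definition vprod :: "nat set \<Rightarrow> nat list" where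
  "vprod B = concat (map vword (rev (sorted_list_of_set B)))"

definition max_letter :: "nat list \<Rightarrow> nat" where
  "max_letter V = Max (set V)"

definition decomp :: "nat list \<Rightarrow> nat set \<times> nat set" where
  "decomp V = (THE (A, B). A \<subseteq> {1..<max_letter V} \<and> B \<subseteq> {1..<max_letter V} \<and>
                 V = uprod A @ [max_letter V] @ vprod B)"

definition eta :: "nat list \<Rightarrow> nat" where
  "eta V = (let k = max_letter V; A = fst (decomp V)
            in if A = {1..<k} then 0 else Max ({1..<k} - A))"

datatype colour = Red | Blue

definition zimin_colour :: "nat list \<Rightarrow> colour" where
  "zimin_colour V = (let (A, B) = decomp V; I = {1..<eta V}
                     in if A \<inter> I = I - (B \<inter> I) then Red else Blue)"

definition pd_colour :: "nat list \<Rightarrow> colour" where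
  "pd_colour u = zimin_colour (lift_factor u)"

text \<open>\<open>y = u\<^sub>0 u\<^sub>1 u\<^sub>2 \<dots>\<close> with nonempty finite words \<open>u\<^sub>i\<close>\<close>

definition factorisation :: "'a word \<Rightarrow> (nat \<Rightarrow> 'a list) \<Rightarrow> bool" where
  "factorisation y u \<longleftrightarrow> (\<forall>i. u i \<noteq> []) \<and>
     (\<forall>n. prefix (length (concat (map u [0..<n]))) y = concat (map u [0..<n]))"

text \<open>
  Super-monochromatic factorisations for a colouring \<open>C\<close> that is meaningful only on the factors
  of \<open>w\<close>: every finite ordered concatenation has to be a factor of \<open>w\<close>.
\<close>

definition super_monochromatic ::
  "'a word \<Rightarrow> ('a list \<Rightarrow> 'c) \<Rightarrow> 'a word \<Rightarrow> (nat \<Rightarrow> 'a list) \<Rightarrow> bool" where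
  "super_monochromatic w C y u \<longleftrightarrow> factorisation y u \<and>
     (\<exists>c. \<forall>ns. ns \<noteq> [] \<and> sorted_wrt (<) ns \<longrightarrow>
        factor w (concat (map u ns)) \<and> C (concat (map u ns)) = c)"

end

theory Submission
  imports Defs "HOL-Library.Nat_Bijection"
begin

text \<open>
  Count positions from \<open>0\<close> and let \<open>s\<close> be the first occurrence of a factor \<open>u\<close> in \<open>D\<close>; then \<open>W(u)\<close>
  is the factor of \<open>Z\<close> at position \<open>s\<close>. The sets \<open>A\<close> and \<open>B\<close> are the binary digits of the numbers
  \<open>a\<close>, \<open>b\<close> of letters to the left and to the right of the greatest letter. That letter sits at
  position \<open>2\<^sup>K - 1\<close>, hence \<open>a\<close> and \<open>s\<close> have complementary digits and \<open>\<eta> - 1 = f\<close> is the greatest number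
  with \<open>2\<^sup>f \<le> s\<close>. Complementarity of the lowest \<open>f\<close> digits of \<open>a\<close> and \<open>b\<close> means that \<open>2\<^sup>f\<close>
  divides \<open>a + b + 1 = |u|\<close>. So, if \<open>s > 0\<close>, \<open>u\<close> is red iff \<open>2\<^sup>f\<close> divides \<open>|u|\<close>.

  Let \<open>p\<^sub>i\<close> be the position of \<open>u\<^sub>i\<close>. A factor of \<open>D\<close> starting at \<open>p < 2\<^sup>E\<close> and covering all
  positions below \<open>2\<^sup>E\<^sup>+\<^sup>2\<close> determines its position modulo \<open>2\<^sup>E\<^sup>+\<^sup>2\<close>. Applied to
  \<open>u\<^sub>0 \<cdots> u\<^sub>i\<^sub>-\<^sub>1 u\<^sub>j \<cdots> u\<^sub>k\<^sub>-\<^sub>1\<close> this gives \<open>p\<^sub>j \<equiv> p\<^sub>i\<close> modulo \<open>2\<^sup>e\<close>, where \<open>2\<^sup>e \<le> p\<^sub>i < 2\<^sup>e\<^sup>+\<^sup>1\<close>,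
  for \<open>i\<close> large. Hence long products \<open>u\<^sub>i \<cdots> u\<^sub>j\<^sub>-\<^sub>1\<close> are red. But the first occurrence of
  \<open>u\<^sub>0 u\<^sub>j \<cdots> u\<^sub>k\<^sub>-\<^sub>1\<close> is at \<open>p\<^sub>j - |u\<^sub>0|\<close>, and if this word were red, then \<open>|u\<^sub>0|\<close> would be
  divisible by a power of two that tends to infinity with \<open>j\<close>.
\<close>

section \<open>Recursion for the Zimin word and the period-doubling word\<close>

lemma zimin_word_pow2: "zimin_word (2 ^ m - 1) = Suc m"
proof -
  have "2 ^ m - 1 < length (zimin (Suc m))"
    by (simp add: length_zimin diff_less_mono)
  from nth_zimin[OF this] show ?thesis by (simp add: length_zimin nth_append)
qed

text \<open>The second copy of \<open>zimin m\<close> inside \<open>zimin (Suc m)\<close> starts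
  right after the middle letter, at position \<open>2 ^ m\<close>.\<close>

lemma zimin_word_pow2_add:
  assumes "i < 2 ^ m - 1"
  shows "zimin_word (2 ^ m + i) = zimin_word i"
proof -
  have "zimin_word (2 ^ m + i) = zimin (Suc m) ! (2 ^ m + i)"
    using assms nth_zimin[of "2 ^ m + i" "Suc m"] by (simp add: length_zimin)
  also have "\<dots> = zimin m ! i"
    using assms by (auto simp: length_zimin nth_append)
  also have "\<dots> = zimin_word i"
    using assms by (simp add: nth_zimin length_zimin)
  finally show ?thesis .
qed

lemma ex_pow2_bounds:
  assumes "0 < (n :: nat)"
  obtains e where "2 ^ e \<le> n" "n < 2 ^ Suc e"
  using ex_power_ivl1[of 2 n] assms by auto

lemma zimin_word_even: "zimin_word (2 * n) = 1"
proof (induction n rule: less_induct)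
  case (less n)
  show ?case
  proof (cases "n = 0")
    case True
    then show ?thesis using zimin_word_pow2[of 0] by simp
  next
    case False
    then obtain m where m: "2 ^ m \<le> n" "n < 2 ^ Suc m"
      by (meson ex_pow2_bounds not_gr_zero)
    then have "zimin_word (2 ^ Suc m + 2 * (n - 2 ^ m)) = zimin_word (2 * (n - 2 ^ m))"
      by (intro zimin_word_pow2_add) auto
    moreover have "2 ^ Suc m + 2 * (n - 2 ^ m) = 2 * n"
      using m by simp
    moreover have "n - 2 ^ m < n"
      using False by simp
    ultimately show ?thesis using less by metis
  qed
qed

text \<open>Induction strips the leading power of two from \<open>Suc n\<close>. Together with
  \<open>zimin_word_even\<close>, the letter at \<open>n\<close> is one more than the exponent of 2
  in \<open>Suc n\<close>.\<close>

lemma zimin_word_odd: "zimin_word (Suc (2 * n)) = Suc (zimin_word n)"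
proof (induction n rule: less_induct)
  case (less n)
  obtain m where m: "2 ^ m \<le> Suc n" "Suc n < 2 ^ Suc m"
    using ex_pow2_bounds[of "Suc n"] by auto
  show ?case
  proof (cases "Suc n = 2 ^ m")
    case True
    then have "n = 2 ^ m - 1" "Suc (2 * n) = 2 ^ Suc m - 1" by simp_all
    then show ?thesis by (metis zimin_word_pow2)
  next
    case False
    define i where "i = n - 2 ^ m"
    have i: "n = 2 ^ m + i" "i < 2 ^ m - 1"
      using m False by (simp_all add: i_def)
    have "zimin_word (2 ^ Suc m + Suc (2 * i)) = zimin_word (Suc (2 * i))"
      using i by (intro zimin_word_pow2_add) simp
    then show ?thesis
      using less.IH[of i] i zimin_word_pow2_add[of i m] by simp
  qed
qed

lemma period_doubling_even: "period_doubling (2 * n) = 0"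
  by (simp add: period_doubling_def psi_def zimin_word_even)

text \<open>With \<open>period_doubling_even\<close> this says that D is fixed by the substitution 0
  -> 01, 1 -> 00.\<close>

lemma period_doubling_odd: "period_doubling (Suc (2 * n)) = 1 - period_doubling n"
  by (simp add: period_doubling_def psi_def zimin_word_odd)

lemma period_doubling_le_1: "period_doubling n \<le> 1"
  by (simp add: period_doubling_def psi_def)

text \<open>D at \<open>n\<close> depends only on the exponent of 2 in \<open>Suc n\<close>, which a
  multiple of \<open>2 ^ M\<close> cannot change while \<open>0 < Suc n < 2 ^ M\<close>.\<close>

lemma period_doubling_add_pow2:
  assumes "Suc n < 2 ^ M"
  shows "period_doubling (n + 2 ^ M * h) = period_doubling n"
  using assms
proof (induction M arbitrary: n)
  case (Suc M)
  show ?case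
  proof (cases "even n")
    case True
    then obtain k where "n = 2 * k" by blast
    moreover have "2 * k + 2 ^ Suc M * h = 2 * (k + 2 ^ M * h)"
      by simp
    ultimately show ?thesis by (metis period_doubling_even)
  next
    case False
    then obtain k where k: "n = Suc (2 * k)" by (metis oddE Suc_eq_plus1)
    moreover have "Suc (2 * k) + 2 ^ Suc M * h = Suc (2 * (k + 2 ^ M * h))"
      by simp
    moreover have "Suc k < 2 ^ M" using Suc.prems k by simp
    ultimately show ?thesis by (metis Suc.IH period_doubling_odd)
  qed
qed simp

section \<open>Recognizability\<close>

lemma period_doubling_1_mod_4: "period_doubling (Suc (4 * n)) = 1"
  using period_doubling_odd[of "2 * n"] period_doubling_even[of n] by simp

text \<open>Desubstitution: for positive \<open>E\<close> the window forces \<open>q\<close> to be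
  odd, and its letters at even offsets are the complement of the window for \<open>E - 1\<close>.
  The base window 0100 occurs only at multiples of 4.\<close>

lemma recognizable_window:
  assumes "\<And>t. t \<le> 3 * 2 ^ E \<Longrightarrow> period_doubling (q + t) = period_doubling (2 ^ E - 1 + t)"
  shows "Suc q mod 2 ^ (E + 2) = 2 ^ E"
  using assms
proof (induction E arbitrary: q)
  case 0
  have D1: "period_doubling 1 = 1" using period_doubling_1_mod_4[of 0] by simp
  have D3: "period_doubling 3 = 0" using period_doubling_odd[of 1] D1 by simp
  have *: "period_doubling (q + 1) = 1" "period_doubling (q + 3) = 0"
    using "0"[of 1] "0"[of 3] D1 D3 by simp_all
  have "even q"
  proof (rule ccontr)
    assume "odd q"
    then have "q + 1 = 2 * ((q + 1) div 2)" by simp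
    then show False using * period_doubling_even by (metis zero_neq_one)
  qed
  moreover have "q mod 4 \<noteq> 2"
  proof
    assume "q mod 4 = 2"
    then have "q + 3 = Suc (4 * ((q + 2) div 4))" by presburger
    then show False using * period_doubling_1_mod_4 by (metis zero_neq_one)
  qed
  ultimately have "q mod 4 = 0" by presburger
  then show ?case by (simp add: mod_Suc)
next
  case (Suc E)
  have large: "3 \<le> 3 * (2 :: nat) ^ Suc E" by simp
  have even_idx: "period_doubling (2 ^ Suc E - 1 + t) = 0" if "odd t" for t
  proof -
    have "even (2 ^ Suc E - 1 + t)" using that by simp
    then show ?thesis by (metis evenE period_doubling_even)
  qed
  \<comment> \<open>The window has 0 at offsets 1 and 3. An even \<open>q\<close> would put one of
    these offsets at a position congruent to 1 modulo 4, where D is 1.\<close>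
  have "odd q"
  proof
    assume "even q"
    then have "q mod 4 = 0 \<or> q mod 4 = 2" by presburger
    then show False
    proof
      assume "q mod 4 = 0"
      then have "q + 1 = Suc (4 * (q div 4))" by presburger
      then show False
        using Suc.prems[of 1] large even_idx[of 1] period_doubling_1_mod_4
        by (metis dual_order.trans odd_one one_le_numeral zero_neq_one)
    next
      assume "q mod 4 = 2"
      then have "q + 3 = Suc (4 * ((q + 2) div 4))" by presburger
      then show False
        using Suc.prems[of 3] large even_idx[of 3] period_doubling_1_mod_4
        by (metis odd_numeral zero_neq_one)
    qed
  qed
  then obtain r where r: "q = Suc (2 * r)" by (metis oddE Suc_eq_plus1)
  have "period_doubling (r + t) = period_doubling (2 ^ E - 1 + t)" if "t \<le> 3 * 2 ^ E" for t
  proof -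
    have "q + 2 * t = Suc (2 * (r + t))" using r by simp
    moreover have "2 ^ Suc E - 1 + 2 * t = Suc (2 * (2 ^ E - 1 + t))"
    proof -
      obtain x where "(2::nat) ^ E = Suc x" by (metis not0_implies_Suc power_not_zero zero_neq_numeral)
      then show ?thesis by simp
    qed
    moreover have "2 * t \<le> 3 * 2 ^ Suc E" using that by simp
    ultimately have "1 - period_doubling (r + t) = 1 - period_doubling (2 ^ E - 1 + t)"
      using Suc.prems[of "2 * t"] by (metis period_doubling_odd)
    then show ?thesis
      using period_doubling_le_1[of "r + t"] period_doubling_le_1[of "2 ^ E - 1 + t"] by linarith
  qed
  then have "Suc r mod 2 ^ (E + 2) = 2 ^ E" by (rule Suc.IH)
  moreover have "Suc q = 2 * Suc r" using r by simp
  moreover have "2 * Suc r mod (2 * 2 ^ (E + 2)) = 2 * (Suc r mod 2 ^ (E + 2))"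
    by (rule mult_mod_right[symmetric])
  ultimately show ?case by simp
qed

lemma recognizable:
  assumes p: "p < 2 ^ E"
    and eq: "\<And>t. p + t < 2 ^ (E + 2) \<Longrightarrow> period_doubling (q + t) = period_doubling (p + t)"
  shows "q mod 2 ^ (E + 2) = p"
proof -
  \<comment> \<open>Skipping \<open>d\<close> letters leads from \<open>p\<close> to the start of
    the recognizable window, which ends at position \<open>2 ^ (E + 2) - 1\<close>.\<close>
  define d where "d = 2 ^ E - 1 - p"
  have d: "p + d = 2 ^ E - 1" using p by (simp add: d_def)
  have "period_doubling (q + d + t) = period_doubling (2 ^ E - 1 + t)" if "t \<le> 3 * 2 ^ E" for t
  proof -
    have "p + (d + t) < 2 ^ (E + 2)"
    proof -
      have "0 < (2::nat) ^ E" by simp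
      then have "p + d < 2 ^ E" using d by linarith
      then show ?thesis using that by (simp add: power_add)
    qed
    from eq[OF this] show ?thesis by (metis add.assoc d)
  qed
  then have "Suc (q + d) mod 2 ^ (E + 2) = 2 ^ E" by (rule recognizable_window)
  then have "(q + Suc d) mod 2 ^ (E + 2) = (p + Suc d) mod 2 ^ (E + 2)"
    using d p by (simp add: mod_less)
  then have "q mod 2 ^ (E + 2) = p mod 2 ^ (E + 2)"
    by (metis add_diff_cancel_right add_le_cancel_right mod_eq_dvd_iff_nat nat_le_linear)
  also have "\<dots> = p"
    using p by (simp add: mod_less)
  finally show ?thesis .
qed

section \<open>The colouring in terms of first occurrences\<close>

lemma subsequence_eq_iff:
  "w [q \<rightarrow> q + length V] = V \<longleftrightarrow> (\<forall>t < length V. w (q + t) = V ! t)"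
proof -
  have "w [q \<rightarrow> q + length V] = V \<longleftrightarrow> (\<forall>t < length V. w [q \<rightarrow> q + length V] ! t = V ! t)"
    by (subst list_eq_iff_nth_eq) simp
  then show ?thesis by simp
qed

section \<open>Products of the words \<open>u\<^sub>m\<close> and \<open>v\<^sub>m\<close>\<close>

lemma sorted_list_of_set_insert_greatest:
  assumes "A \<subseteq> {1..K}"
  shows "sorted_list_of_set (insert (Suc K) A) = sorted_list_of_set A @ [Suc K]"
proof -
  have fin: "finite A" using assms finite_subset by blast
  show ?thesis
  proof (rule sorted_distinct_set_unique)
    show "sorted (sorted_list_of_set A @ [Suc K])"
      using fin assms by (force simp: sorted_append)
    show "distinct (sorted_list_of_set A @ [Suc K])"
      using fin assms by auto
    show "set (sorted_list_of_set (insert (Suc K) A)) = set (sorted_list_of_set A @ [Suc K])"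
      using fin by (simp del: sorted_list_of_set_insert_remove)
  qed (simp_all del: sorted_list_of_set_insert_remove)
qed

lemma uprod_insert_greatest:
  "A \<subseteq> {1..K} \<Longrightarrow> uprod (insert (Suc K) A) = uprod A @ uword (Suc K)"
  unfolding uprod_def by (subst sorted_list_of_set_insert_greatest) simp_all

lemma vprod_insert_greatest:
  "A \<subseteq> {1..K} \<Longrightarrow> vprod (insert (Suc K) A) = vword (Suc K) @ vprod A"
  unfolding vprod_def by (subst sorted_list_of_set_insert_greatest) simp_all

lemma sorted_list_of_set_atLeastAtMost: "sorted_list_of_set {1..K} = [1..<Suc K]"
  by (metis atLeastLessThanSuc_atLeastAtMost sorted_list_of_set_range)

lemma uword_Suc: "uword (Suc K) = Suc K # uprod {1..K}"
  unfolding uprod_def sorted_list_of_set_atLeastAtMost by (rule uword.simps)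

lemma vword_Suc: "vword (Suc K) = vprod {1..K} @ [Suc K]"
  unfolding vprod_def sorted_list_of_set_atLeastAtMost by (rule vword.simps)

lemma uprod_full: "uprod {1..K} = zimin K"
proof (induction K)
  case (Suc K)
  have "{1..Suc K} = insert (Suc K) {1..K}" by auto
  then show ?case
    using Suc by (simp add: uprod_insert_greatest uword_Suc)
qed (simp add: uprod_def)

lemma vprod_full: "vprod {1..K} = zimin K"
proof (induction K)
  case (Suc K)
  have "{1..Suc K} = insert (Suc K) {1..K}" by auto
  then show ?case
    using Suc by (simp add: vprod_insert_greatest vword_Suc)
qed (simp add: vprod_def)

text \<open>For positive \<open>i\<close>, \<open>uword i\<close> and \<open>vword i\<close> have
  length \<open>2 ^ (i - 1)\<close>, so this is the common length of \<open>uprod A\<close> and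
  \<open>vprod A\<close> for finite sets of positive indices.\<close>

definition binval :: "nat set \<Rightarrow> nat" where
  "binval A = (\<Sum>i\<in>A. 2 ^ (i - 1))"

lemma binval_insert_greatest:
  assumes "A \<subseteq> {1..K}"
  shows "binval (insert (Suc K) A) = 2 ^ K + binval A"
proof -
  have "finite A" "Suc K \<notin> A" using assms finite_subset by auto
  then show ?thesis by (simp add: binval_def)
qed

lemma subset_Suc_cases:
  assumes "A \<subseteq> {1..Suc K}"
  obtains "A \<subseteq> {1..K}" | A' where "A = insert (Suc K) A'" "A' \<subseteq> {1..K}"
proof (cases "Suc K \<in> A")
  case True
  then have "A = insert (Suc K) (A - {Suc K})" by blast
  moreover have "A - {Suc K} \<subseteq> {1..K}" using assms by (auto simp: le_Suc_eq)
  ultimately show ?thesis using that by blast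
next
  case False
  then have "A \<subseteq> {1..K}" using assms by (auto simp: le_Suc_eq)
  then show ?thesis by (rule that)
qed

text \<open>A suffix is determined by its length, and \<open>binval\<close> attains every length up
  to that of \<open>zimin K\<close>; hence every suffix of \<open>zimin K\<close> is some
  \<open>uprod A\<close>.\<close>

lemma uprod_suffix_zimin:
  assumes "A \<subseteq> {1..K}"
  shows "\<exists>xs. zimin K = xs @ uprod A \<and> length (uprod A) = binval A"
  using assms
proof (induction K arbitrary: A)
  case (Suc K)
  from Suc.prems show ?case
  proof (cases rule: subset_Suc_cases)
    case 1
    then show ?thesis using Suc.IH[OF 1] by auto
  next
    case (2 A')
    then show ?thesis
      using Suc.IH[OF 2(2)]
      by (auto simp: uprod_insert_greatest uword_Suc binval_insert_greatest
          uprod_full[simplified] length_zimin)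
  qed
qed (simp add: uprod_def binval_def)

lemma vprod_prefix_zimin:
  assumes "B \<subseteq> {1..K}"
  shows "\<exists>xs. zimin K = vprod B @ xs \<and> length (vprod B) = binval B"
  using assms
proof (induction K arbitrary: B)
  case (Suc K)
  from Suc.prems show ?case
  proof (cases rule: subset_Suc_cases)
    case 1
    then show ?thesis using Suc.IH[OF 1] by auto
  next
    case (2 B')
    then show ?thesis
      using Suc.IH[OF 2(2)]
      by (auto simp: vprod_insert_greatest vword_Suc binval_insert_greatest
          vprod_full[simplified] length_zimin)
  qed
qed (simp add: vprod_def binval_def)

lemma set_zimin: "set (zimin K) \<subseteq> {1..K}"
  by (induction K) auto

section \<open>Binary digits\<close>

definition digits :: "nat \<Rightarrow> nat set" where
  "digits a = {i. 0 < i \<and> odd (a div 2 ^ (i - 1))}"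

lemma digits_eq: "digits a = Suc ` set_decode a"
proof (rule set_eqI)
  fix i show "i \<in> digits a \<longleftrightarrow> i \<in> Suc ` set_decode a"
    by (cases i) (auto simp: digits_def set_decode_def)
qed

lemma digits_subset:
  assumes "a < 2 ^ K"
  shows "digits a \<subseteq> {1..K}"
proof
  fix i assume i: "i \<in> digits a"
  then have "a div 2 ^ (i - 1) \<noteq> 0" unfolding digits_def by (metis even_zero mem_Collect_eq)
  then have "(2::nat) ^ (i - 1) \<le> a" by (metis div_less not_le)
  then have "(2::nat) ^ (i - 1) < 2 ^ K" using assms by linarith
  then have "i - 1 < K" by simp
  then show "i \<in> {1..K}" using i by (auto simp: digits_def)
qed

lemma binval_digits: "binval (digits a) = a"
proof -
  have "binval (digits a) = set_encode (set_decode a)"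
    unfolding digits_eq binval_def set_encode_def by (subst sum.reindex) auto
  then show ?thesis by simp
qed

lemma digits_binval:
  assumes "A \<subseteq> {1..K}"
  shows "digits (binval A) = A"
proof -
  have "finite A" "0 \<notin> A" using assms finite_subset by auto
  have "inj_on (\<lambda>i. i - 1) A" using \<open>0 \<notin> A\<close> by (metis One_nat_def inj_on_diff_nat less_one not_le)
  then have "binval A = set_encode ((\<lambda>i. i - 1) ` A)"
    unfolding binval_def set_encode_def by (subst sum.reindex) auto
  then have "digits (binval A) = Suc ` (\<lambda>i. i - 1) ` A"
    using \<open>finite A\<close> by (simp add: digits_eq)
  also have "\<dots> = A"
    unfolding image_image using \<open>0 \<notin> A\<close>
    by (intro trans[OF image_cong image_ident]) (auto intro!: Suc_pred gr0I simp del: Suc_pred)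
  finally show ?thesis .
qed

text \<open>Complementary low digits add up without carry to \<open>2 ^ e - 1\<close>. The induction
  splits off the lowest digit: exactly one of \<open>a\<close>, \<open>b\<close> is odd, and the
  halves satisfy the claim.\<close>

lemma digits_complementary_iff:
  "(\<forall>i\<in>{1..e}. i \<in> digits a \<longleftrightarrow> i \<notin> digits b) \<longleftrightarrow> 2 ^ e dvd a + b + 1"
proof (induction e arbitrary: a b)
  case (Suc e)
  have digits_half: "Suc i \<in> digits a \<longleftrightarrow> i \<in> digits (a div 2)" if "0 < i" for i a
    using that by (cases i) (simp_all add: digits_def div_mult2_eq)
  have digits_1: "1 \<in> digits a \<longleftrightarrow> odd a" for a
    by (simp add: digits_def)
  have "{1..Suc e} = insert 1 (Suc ` {1..e})"
    by auto
  moreover have "0 < i" if "i \<in> {1..e}" for i using that by simp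
  ultimately have "(\<forall>i\<in>{1..Suc e}. i \<in> digits a \<longleftrightarrow> i \<notin> digits b) \<longleftrightarrow>
      (odd a \<longleftrightarrow> even b) \<and> (\<forall>i\<in>{1..e}. i \<in> digits (a div 2) \<longleftrightarrow> i \<notin> digits (b div 2))"
    using digits_half digits_1 by (simp only: ball_simps(5,7) ball_simps(9) cong: ball_cong) blast
  also have "\<dots> \<longleftrightarrow> odd (a + b) \<and> 2 ^ e dvd a div 2 + b div 2 + 1"
    unfolding Suc.IH by auto
  also have "\<dots> \<longleftrightarrow> 2 ^ Suc e dvd a + b + 1"
  proof (cases "odd (a + b)")
    case True
    then have "a + b + 1 = 2 * (a div 2 + b div 2 + 1)" by presburger
    then show ?thesis using True by (simp only: power_Suc nat_mult_dvd_cancel_disj) simp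
  next
    case False
    then have "\<not> 2 dvd a + b + 1" by simp
    then show ?thesis using False by (meson dvd_power dvd_trans zero_less_Suc)
  qed
  finally show ?case .
qed simp

section \<open>Colours of factors of Z\<close>

lemma decomp_uprod_vprod:
  assumes V: "V = uprod A @ [Suc K] @ vprod B" and A: "A \<subseteq> {1..K}" and B: "B \<subseteq> {1..K}"
  shows "max_letter V = Suc K" "decomp V = (A, B)"
proof -
  have u: "set (uprod A') \<subseteq> {1..K} \<and> length (uprod A') = binval A'" if "A' \<subseteq> {1..K}" for A'
    using uprod_suffix_zimin[OF that] set_zimin[of K] by auto
  have v: "set (vprod A') \<subseteq> {1..K} \<and> length (vprod A') = binval A'" if "A' \<subseteq> {1..K}" for A'
    using vprod_prefix_zimin[OF that] set_zimin[of K] by auto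
  show max: "max_letter V = Suc K"
    unfolding max_letter_def using V u[OF A] v[OF B] by (intro Max_eqI) auto
  \<comment> \<open>The single occurrence of \<open>Suc K\<close> separates the two products, and
    their lengths give back the index sets.\<close>
  have uniq: "A' = A \<and> B' = B"
    if "A' \<subseteq> {1..K}" "B' \<subseteq> {1..K}" "V = uprod A' @ [Suc K] @ vprod B'" for A' B'
  proof -
    have "Suc K \<notin> set (uprod A')" "Suc K \<notin> set (uprod A)" "Suc K \<notin> set (vprod B)"
      using u[OF A] u[OF that(1)] v[OF B] by force+
    then have "uprod A' = uprod A" "vprod B' = vprod B"
      using that(3) V by (auto simp: append_Cons_eq_iff)
    then show ?thesis
      using u v A B that by (metis digits_binval)
  qed
  show "decomp V = (A, B)"
    unfolding decomp_def max
    by (rule the_equality) (use uniq V A B in \<open>auto simp: atLeastLessThanSuc_atLeastAtMost\<close>)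
qed

lemma zimin_colour_subsequence:
  assumes s: "2 ^ f \<le> s" "s < 2 ^ Suc f" and L: "s < L"
  shows "zimin_colour (zimin_word [s \<rightarrow> s + L]) = Red \<longleftrightarrow> 2 ^ f dvd L"
proof -
  define V where "V = zimin_word [s \<rightarrow> s + L]"
  obtain K where K: "2 ^ K \<le> s + L" "s + L < 2 ^ Suc K"
    using L ex_pow2_bounds[of "s + L"] by auto
  \<comment> \<open>Since \<open>2 * s < s + L < 2 ^ Suc K\<close>, the greatest letter, at position
    \<open>2 ^ K - 1\<close>, lies inside the factor.\<close>
  have sK: "s < 2 ^ K" using K L by simp
  then have "(2::nat) ^ f < 2 ^ K" using s by linarith
  then have fK: "f < K" by simp
  define a where "a = 2 ^ K - 1 - s"
  define b where "b = s + L - 2 ^ K"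
  have as: "a + s + 1 = 2 ^ K" using sK by (simp add: a_def)
  have ab: "a + b + 1 = L" using as K by (simp add: b_def)
  have a: "digits a \<subseteq> {1..K}" and b: "digits b \<subseteq> {1..K}"
    using as K by (intro digits_subset; simp add: b_def)+
  have "V = take L (drop s (zimin (Suc K)))"
    unfolding V_def
  proof (rule nth_equalityI)
    fix i assume "i < length (zimin_word [s \<rightarrow> s + L])"
    then show "zimin_word [s \<rightarrow> s + L] ! i = take L (drop s (zimin (Suc K))) ! i"
      using K nth_zimin[of "s + i" "Suc K"] by (simp add: length_zimin del: zimin.simps)
  qed (use K in \<open>simp add: length_zimin\<close>)
  also have "\<dots> = drop s (zimin K) @ [Suc K] @ take b (zimin K)"
  proof -
    have "L - (2 ^ K - 1 - s) = Suc b" "s - (2 ^ K - 1) = 0" using as ab by auto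
    then show ?thesis using as by (simp add: length_zimin)
  qed
  also have "drop s (zimin K) = uprod (digits a)"
  proof -
    obtain xs where "zimin K = xs @ uprod (digits a)" "length (uprod (digits a)) = a"
      using uprod_suffix_zimin[OF a] binval_digits by metis
    moreover have "length (zimin K) = a + s" using as by (simp add: length_zimin)
    ultimately show ?thesis by simp
  qed
  also have "take b (zimin K) = vprod (digits b)"
    using vprod_prefix_zimin[OF b] binval_digits by (metis append_eq_conv_conj)
  finally have V: "V = uprod (digits a) @ [Suc K] @ vprod (digits b)" .
  note dec = decomp_uprod_vprod[OF V a b]
  have compl: "i \<in> digits a \<longleftrightarrow> i \<notin> digits s" if "i \<in> {1..K}" for i
    using digits_complementary_iff[of K a s] as that by simp
  have "s div 2 ^ f = 1"
    using s by (intro div_nat_eqI) auto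
  then have top: "Suc f \<in> digits s"
    by (simp add: digits_def)
  \<comment> \<open>The indices missing from \<open>digits a\<close> are the digits of
    \<open>s\<close>. Index \<open>Suc f\<close> stands for \<open>2 ^ f\<close>, the leading one,
    so the colour compares the indices in \<open>{1..f}\<close>.\<close>
  have "eta V = Suc f"
  proof -
    have "Suc f \<in> {1..K} - digits a" using top fK compl by auto
    moreover have "Max ({1..K} - digits a) = Suc f"
    proof (rule Max_eqI)
      fix i assume "i \<in> {1..K} - digits a"
      then have "i \<in> digits s" using compl by blast
      then show "i \<le> Suc f" using digits_subset[OF s(2)] by auto
    qed (use \<open>Suc f \<in> {1..K} - digits a\<close> in auto)
    ultimately show ?thesis
      by (auto simp: eta_def dec Let_def atLeastLessThanSuc_atLeastAtMost)
  qed
  then have "zimin_colour V = Red \<longleftrightarrow> (\<forall>i\<in>{1..f}. i \<in> digits a \<longleftrightarrow> i \<notin> digits b)"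
    by (auto simp: zimin_colour_def dec Let_def atLeastLessThanSuc_atLeastAtMost)
  then show ?thesis
    unfolding digits_complementary_iff ab V_def .
qed

section \<open>Colours of factors of D\<close>

lemma map_psi_subsequence: "map psi (zimin_word [i \<rightarrow> j]) = period_doubling [i \<rightarrow> j]"
  by (simp add: period_doubling_def subsequence_def)

text \<open>Any occurrence in Z of a word with image \<open>u\<close> is an occurrence of
  \<open>u\<close> in D at the same position, so none starts before \<open>s\<close>. Only one word
  of this length starts at \<open>s\<close>, so \<open>ARG_MIN\<close> has no choice.\<close>

lemma lift_factor_eq:
  assumes "factor period_doubling u"
  defines "s \<equiv> first_occ period_doubling u"
  shows "lift_factor u = zimin_word [s \<rightarrow> s + length u]"
proof -
  let ?P = "\<lambda>V. factor zimin_word V \<and> map psi V = u"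
  define V where "V = zimin_word [s \<rightarrow> s + length u]"
  have s: "period_doubling [s \<rightarrow> s + length u] = u"
    using assms LeastI_ex[of "\<lambda>i. period_doubling [i \<rightarrow> i + length u] = u"]
    unfolding factor_def first_occ_def by simp
  have lenV: "length V = length u" by (simp add: V_def)
  have occ: "zimin_word [first_occ zimin_word V' \<rightarrow> first_occ zimin_word V' + length u] = V'
      \<and> s \<le> first_occ zimin_word V'" if "?P V'" for V'
  proof -
    have len: "length V' = length u" using that by auto
    have V': "zimin_word [first_occ zimin_word V' \<rightarrow> first_occ zimin_word V' + length u] = V'"
      using that len LeastI_ex[of "\<lambda>i. zimin_word [i \<rightarrow> i + length V'] = V'"]
      unfolding factor_def first_occ_def by simp
    then have "period_doubling [first_occ zimin_word V' \<rightarrow> first_occ zimin_word V' + length u] = u"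
      using that by (metis map_psi_subsequence)
    then show ?thesis
      using V' unfolding s_def by (simp add: first_occ_def[of period_doubling] Least_le)
  qed
  have PV: "?P V"
    using s lenV by (auto simp: factor_def V_def map_psi_subsequence)
  have "first_occ zimin_word V \<le> s"
    unfolding first_occ_def[of zimin_word] by (rule Least_le) (simp add: V_def)
  then have fV: "first_occ zimin_word V = s" using occ[OF PV] by simp
  have "is_arg_min (first_occ zimin_word) ?P (lift_factor u)"
    unfolding lift_factor_def arg_min_def
    by (rule someI[of _ V]) (use PV fV occ in \<open>auto simp: is_arg_min_def not_less\<close>)
  then have "?P (lift_factor u)" "first_occ zimin_word (lift_factor u) \<le> s"
    using PV fV by (auto simp: is_arg_min_def not_less)
  then show ?thesis
    using occ[of "lift_factor u"] by simp
qed

lemma pd_colour_eq_Red_iff: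
  assumes occ: "period_doubling [s \<rightarrow> s + length u] = u"
    and first: "\<And>q. period_doubling [q \<rightarrow> q + length u] = u \<Longrightarrow> s \<le> q"
    and s: "2 ^ f \<le> s" "s < 2 ^ Suc f" and L: "s < length u"
  shows "pd_colour u = Red \<longleftrightarrow> 2 ^ f dvd length u"
proof -
  have "first_occ period_doubling u = s"
    unfolding first_occ_def using occ first by (rule Least_equality)
  moreover have "factor period_doubling u"
    using occ by (auto simp: factor_def)
  ultimately show ?thesis
    unfolding pd_colour_def by (simp only: lift_factor_eq zimin_colour_subsequence[OF s L])
qed

section \<open>Factorisations of suffixes\<close>

lemma factorisation_concat:
  fixes w :: "'a word"
  assumes fac: "factorisation (suffix n w) u"
  defines "p \<equiv> \<lambda>i. n + length (concat (map u [0..<i]))"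
  shows "strict_mono p"
    and "i \<le> j \<Longrightarrow> length (concat (map u [i..<j])) = p j - p i"
    and "i \<le> j \<Longrightarrow> p i + t < p j \<Longrightarrow> concat (map u [i..<j]) ! t = w (p i + t)"
proof -
  show "strict_mono p"
    unfolding strict_mono_Suc_iff using fac by (auto simp: p_def factorisation_def)
  have split: "concat (map u [0..<j]) = concat (map u [0..<i]) @ concat (map u [i..<j])"
    if "i \<le> j" for i j
    using that by (metis concat_append map_append le_Suc_ex upt_add_eq_append zero_le)
  show "length (concat (map u [i..<j])) = p j - p i" if "i \<le> j"
    using split[OF that] by (simp add: p_def)
  show "concat (map u [i..<j]) ! t = w (p i + t)" if "i \<le> j" "p i + t < p j"
  proof -
    let ?l = "length (concat (map u [0..<i]))"
    have "concat (map u [i..<j]) ! t = concat (map u [0..<j]) ! (?l + t)"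
      by (simp only: split[OF that(1)] nth_append_length_plus)
    also have "\<dots> = prefix (length (concat (map u [0..<j]))) (suffix n w) ! (?l + t)"
      using fac by (simp add: factorisation_def)
    also have "\<dots> = w (p i + t)"
      using that by (simp add: p_def add.assoc)
    finally show ?thesis .
  qed
qed

theorem theorem4:
  shows "\<not> (\<exists>n u. super_monochromatic period_doubling pd_colour (suffix n period_doubling) u)"
proof
  assume "\<exists>n u. super_monochromatic period_doubling pd_colour (suffix n period_doubling) u"
  then obtain n u where "super_monochromatic period_doubling pd_colour (suffix n period_doubling) u"
    by (elim exE)
  then obtain c where fac: "factorisation (suffix n period_doubling) u"
    and mono: "\<And>ns. ns \<noteq> [] \<Longrightarrow> sorted_wrt (<) ns \<Longrightarrow>
        factor period_doubling (concat (map u ns)) \<and> pd_colour (concat (map u ns)) = c"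
    unfolding super_monochromatic_def by metis
  define p where "p i = n + length (concat (map u [0..<i]))" for i
  define blk where "blk i j = concat (map u [i..<j])" for i j
  note fc = factorisation_concat[OF fac, folded p_def blk_def]
  have p_mono: "strict_mono p" by (rule fc(1))
  have len: "length (blk i j) = p j - p i" if "i \<le> j" for i j
    using fc(2)[OF that] by simp
  have nth: "blk i j ! t = period_doubling (p i + t)" if "i \<le> j" "p i + t < p j" for i j t
    using fc(3)[OF that] by simp
  have p_less: "p i < p j \<longleftrightarrow> i < j" for i j
    using p_mono by (rule strict_mono_less)
  have p_large: "\<exists>j > i. x \<le> p j" for i x
  proof -
    have "i + x + 1 \<le> p (i + x + 1)"
      using p_mono by (rule strict_mono_imp_increasing)
    then show ?thesis by (intro exI[of _ "i + x + 1"]) auto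
  qed
  have blk_pos: "q mod 2 ^ (M + 2) = p i"
    if pi: "p i < 2 ^ M" and pj: "2 ^ (M + 2) \<le> p j"
      and occ: "\<And>t. t < p j - p i \<Longrightarrow> period_doubling (q + t) = blk i j ! t"
    for i j M q
  proof (rule recognizable[OF pi])
    fix t assume t: "p i + t < 2 ^ (M + 2)"
    have "i \<le> j"
      using t pj p_less[of i j] by linarith
    then show "period_doubling (q + t) = period_doubling (p i + t)"
      using occ[of t] nth[of i j t] t pj by simp
  qed
  obtain E where E: "p 0 < 2 ^ E" using less_exp by blast
  have cong: "2 ^ e dvd p j - p i" if pi: "2 ^ e \<le> p i" and Ee: "E + 2 \<le> e" and ij: "i < j" for i j e
  proof -
    \<comment> \<open>With \<open>e = E' + 2\<close>, the part \<open>blk 0 i\<close> starts below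
      \<open>2 ^ E'\<close> and reaches \<open>2 ^ (E' + 2)\<close>, so it fixes \<open>q\<close>
      modulo \<open>2 ^ e\<close>. The part \<open>blk j k\<close> fixes
      \<open>q + (p i - p 0)\<close> modulo a higher power; comparing the two gives the
      claim.\<close>
    obtain E' where E': "e = E' + 2" "E \<le> E'" using le_Suc_ex[OF Ee] by auto
    have p0: "p 0 < 2 ^ E'" using E E'(2) by (meson less_le_trans one_le_numeral power_increasing)
    then have p0e: "p 0 < 2 ^ e" using E'(1) by (simp add: power_add)
    obtain M where M: "p j < 2 ^ M" using less_exp by blast
    obtain k where k: "j < k" "2 ^ (M + 2) \<le> p k" using p_large by blast
    have "i \<noteq> 0" using pi p0e by (cases i) auto
    have "factor period_doubling (blk 0 i @ blk j k)"
      using mono[of "[0..<i] @ [j..<k]"] \<open>i \<noteq> 0\<close> ij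
      by (auto simp: blk_def sorted_wrt_append)
    then obtain q where q: "\<And>t. t < length (blk 0 i @ blk j k) \<Longrightarrow>
        period_doubling (q + t) = (blk 0 i @ blk j k) ! t"
      unfolding factor_def subsequence_eq_iff by blast
    have "q mod 2 ^ (E' + 2) = p 0"
      by (rule blk_pos[OF p0, of i]) (use q len[of 0 i] pi E'(1) in \<open>auto simp: nth_append\<close>)
    then have 1: "q mod 2 ^ e = p 0" using E' by simp
    have "(q + (p i - p 0)) mod 2 ^ (M + 2) = p j"
    proof (rule blk_pos[OF M k(2)])
      fix t assume "t < p k - p j"
      then show "period_doubling (q + (p i - p 0) + t) = blk j k ! t"
        using q[of "p i - p 0 + t"] len[of 0 i] len[of j k] k by (simp add: nth_append add.assoc)
    qed
    moreover have "e \<le> M + 2"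
    proof -
      have "(2::nat) ^ e < 2 ^ M" using pi ij M p_less[of i j] by linarith
      then show ?thesis by simp
    qed
    ultimately have 2: "(q + (p i - p 0)) mod 2 ^ e = p j mod 2 ^ e"
      by (metis le_imp_power_dvd mod_mod_cancel)
    have "p j mod 2 ^ e = (p 0 + (p i - p 0)) mod 2 ^ e"
      using 1 2 by (metis mod_add_left_eq)
    also have "p 0 + (p i - p 0) = p i" using p0e pi by simp
    finally show ?thesis
      using mod_eq_dvd_iff_nat p_less ij by (metis less_imp_le)
  qed

  have "c = Red"
  proof -
    obtain i where i: "2 ^ (E + 2) \<le> p i" using p_large by blast
    then have "0 < p i" by (rule less_le_trans[rotated]) simp
    then obtain e where e: "2 ^ e \<le> p i" "p i < 2 ^ Suc e" using ex_pow2_bounds by blast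
    have "(2::nat) ^ (E + 2) < 2 ^ Suc e" using i e by linarith
    then have "E + 2 < Suc e" by (rule power_less_imp_less_exp[rotated]) simp
    then have Ee: "E + 2 \<le> e" by simp
    \<comment> \<open>This bound makes the block recognizable with \<open>M = Suc e\<close>, so that
      \<open>p i\<close> is its first occurrence, and also longer than \<open>p i\<close>.\<close>
    obtain j where j: "i < j" "2 ^ (Suc e + 2) \<le> p j" using p_large by blast
    have L: "length (blk i j) = p j - p i" using len j by simp
    have "pd_colour (blk i j) = Red \<longleftrightarrow> 2 ^ e dvd length (blk i j)"
    proof (rule pd_colour_eq_Red_iff[OF _ _ e])
      show "period_doubling [p i \<rightarrow> p i + length (blk i j)] = blk i j"
        unfolding subsequence_eq_iff using nth[of i j] j(1) L by simp
      show "p i < length (blk i j)" using L e j by simp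
      fix q assume "period_doubling [q \<rightarrow> q + length (blk i j)] = blk i j"
      then have "q mod 2 ^ (Suc e + 2) = p i"
        unfolding subsequence_eq_iff using L by (intro blk_pos[OF e(2) j(2)]) simp
      then show "p i \<le> q" by (metis mod_less_eq_dividend)
    qed
    moreover have "2 ^ e dvd length (blk i j)"
      using cong[OF e(1) Ee j(1)] L by simp
    ultimately show ?thesis
      using mono[of "[i..<j]"] j by (simp add: blk_def)
  qed

  define l where "l = p 1 - p 0"
  have l: "0 < l" "length (u 0) = l"
    using p_less[of 0 1] len[of 0 1] by (simp_all add: l_def blk_def)
  \<comment> \<open>The summand \<open>3 * l\<close> gives \<open>2 * l < s < 2 ^ Suc f\<close>,
    hence \<open>l < 2 ^ f\<close>, which contradicts the divisibility reached at the end.\<close>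
  obtain j where j: "1 < j" "2 ^ (E + 2) + 3 * l \<le> p j" using p_large by blast
  define s where "s = p j - l"
  have sl: "s + l = p j" using j by (simp add: s_def)
  obtain e where e: "2 ^ e \<le> p j" "p j < 2 ^ Suc e"
    using ex_pow2_bounds[of "p j"] j l by auto
  have "(2::nat) ^ (E + 2) < 2 ^ Suc e" using j e by linarith
  then have "E + 2 < Suc e" by (rule power_less_imp_less_exp[rotated]) simp
  then have Ee: "E + 2 \<le> e" by simp
  obtain f where f: "2 ^ f \<le> s" "s < 2 ^ Suc f"
    using ex_pow2_bounds[of s] j l sl by auto
  have "(2::nat) ^ f < 2 ^ Suc e" using f e sl by linarith
  then have "f < Suc e" by (rule power_less_imp_less_exp[rotated]) simp
  then have "f \<le> e" by simp
  obtain k where k: "j < k" "2 ^ (Suc e + 2) \<le> p k" using p_large by blast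
  define U where "U = u 0 @ blk j k"
  have lenU: "length U = l + (p k - p j)" using l len k by (simp add: U_def)
  have U: "factor period_doubling U" "pd_colour U = Red"
    using mono[of "0 # [j..<k]"] j \<open>c = Red\<close> by (auto simp: U_def blk_def)
  have U_pos: "(q + l) mod 2 ^ (Suc e + 2) = p j"
    if "period_doubling [q \<rightarrow> q + length U] = U" for q
  proof (rule blk_pos[OF e(2) k(2)])
    fix t assume "t < p k - p j"
    then have "period_doubling (q + (l + t)) = U ! (l + t)"
      using that lenU unfolding subsequence_eq_iff by simp
    then show "period_doubling (q + l + t) = blk j k ! t"
      using l by (simp add: U_def nth_append add.assoc)
  qed
  \<comment> \<open>A residue is at most the number itself, so
    \<open>p j \<le> q + l\<close>.\<close>
  have first: "s \<le> q" if "period_doubling [q \<rightarrow> q + length U] = U" for q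
    using U_pos[OF that] sl by (metis add_le_cancel_right mod_less_eq_dividend)
  have occ: "period_doubling [s \<rightarrow> s + length U] = U"
    unfolding subsequence_eq_iff
  proof (intro allI impI)
    fix t assume t: "t < length U"
    obtain q where q: "period_doubling [q \<rightarrow> q + length U] = U"
      using U(1) by (auto simp: factor_def)
    show "period_doubling (s + t) = U ! t"
    proof (cases "t < l")
      case True
      \<comment> \<open>That \<open>u 0\<close> also precedes position \<open>p j\<close> in D is
        seen from some occurrence \<open>q\<close> of \<open>U\<close>: \<open>q\<close> and
        \<open>s\<close> differ by a multiple of \<open>2 ^ (Suc e + 2)\<close>, a period for the
        small positions \<open>s + t < p j\<close>.\<close>
      define h where "h = (q + l) div 2 ^ (Suc e + 2)"
      have "q + l = p j + 2 ^ (Suc e + 2) * h"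
        using U_pos[OF q] unfolding h_def by (metis mod_mult_div_eq)
      then have "q + t = (s + t) + 2 ^ (Suc e + 2) * h" using sl by linarith
      moreover have "Suc (s + t) < 2 ^ (Suc e + 2)"
        using sl True e by simp
      ultimately have "period_doubling (q + t) = period_doubling (s + t)"
        by (metis period_doubling_add_pow2)
      then show ?thesis using q t unfolding subsequence_eq_iff by simp
    next
      case False
      then have "s + t = p j + (t - l)" using sl by simp
      then show ?thesis
        using False t lenU nth[of j k "t - l"] k l by (simp add: U_def nth_append)
    qed
  qed
  have "s < length U" using lenU sl e k by simp
  then have "2 ^ f dvd l + (p k - p j)"
    using pd_colour_eq_Red_iff[OF occ first f] U(2) lenU by simp
  moreover have "2 ^ f dvd p k - p j"
    using cong[OF e(1) Ee k(1)] \<open>f \<le> e\<close> by (meson dvd_trans le_imp_power_dvd)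
  ultimately have "2 ^ f dvd l" by (metis dvd_add_left_iff)
  then have "2 ^ f \<le> l" using l by (simp add: dvd_imp_le)
  then show False using f(2) j(2) sl l by simp
qed

end
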